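(* There exist a finite set $K$ of colors, a palette $P$ (a finite set of tiles with colors in $K$) and a map $f:K\to\{0,1\}$ such that at least one $P$-tiling exists and, for every $P$-tiling $T$, the $\{0,1\}$-coloring $f\circ T$ belongs to the set $S$ of all 2-adic shifts and reflections of the central tiling $C$; that is, there exist 2-adic integers $a,b\in\mathbb{Z}_2$ and bits $d_1,d_2\in\{0,1\}$ with $f\circ T=T_{a,b,d_1,d_2}$.
   Context: Let $G$ be the grid of unit-length edges between integer points of the plane. A tiling with color set $K$ is a map $T$ from the edges of $G$ to $K$. A tile of $T$ is the ordered quadruple of colors of the four edges bounding a unit square of $G$. A palette is a finite set $P$ of such ordered quadruples, and a $P$-tiling is a tiling all of whose tiles belong to $P$. A palette $P$ together with a map $f$ from its colors to a color set enforces a set $S$ of tilings if replacing every color $c$ by $f(c)$ turns each $P$-tiling into a tiling belonging to $S$. 2-adic notation. $\mathbb{Z}_2$ denotes the ring of 2-adic integers, i.e. formal sums $\sum_{i\ge 0}a_i2^i$ with $a_i\in\{0,1\}$, with the usual addition and multiplication; $\mathbb{Z}\subset\mathbb{Z}_2$, and for instance $-1=\sum_{i\ge0}2^i$. Every nonzero $z\in\mathbb{Z}_2$ can be written uniquely as $z=(2i+1)2^k$ with $k\ge 0$ an integer (the rank of $z$) and $i\in\mathbb{Z}_2$. For $d\in\{0,1\}$ put $\beta_d(z)=i\bmod 2$ (equivalently, the binary digit of $z$ in position $k+1$) when $z\ne0$, and $\beta_d(0)=d$. The value $\beta$ is called the bracket bit, viewed as the direction of a bracket. The central tiling $C$ and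 its shifts and reflections. For $a,b\in\mathbb{Z}_2$ and $d_1,d_2\in\{0,1\}$, let $T_{a,b,d_1,d_2}$ be the $\{0,1\}$-coloring of the edges of $G$ that gives each vertical edge with horizontal coordinate $x\in\mathbb{Z}$ the bit $\beta_{d_1}(x-a)$, and each horizontal edge with vertical coordinate $y\in\mathbb{Z}$ the bit $\beta_{d_2}(y-b)$. The central tiling is $C=T_{0,0,d_1,d_2}$. Its vertical edges at $x=(2i+1)2^k$ carry the bit $i\bmod 2$, and its horizontal edges at $y=(2j+1)2^k$ carry $j\bmod 2$. The edges on the axes carry arbitrary default bits $d_1,d_2$. For an integer $n$, the shift of $C$ by $n$ along the $x$-axis sends the bit at $x$ to position $x+n$. A 2-adic shift by $a$ is the pointwise limit of the shifts by integers approximating $a$ 2-adically. The reflection $x\mapsto -x$ reverses all brackets and the signs of their locations, and it also reverses the default. In the same way one has shifts and reflections in the vertical coordinate, and the diagonal reflection that exchanges the two coordinates. The set $S$ of all tilings obtainable from $C$ by 2-adic shifts and these reflections is exactly $S=\{T_{a,b,d_1,d_2}: a,b\in\mathbb{Z}_2,\ d_1,d_2\in\{0,1\}\}$. *)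

theory Defs
  imports Main
begin

section \<open>The ring of 2-adic integers\<close>

text \<open>
  A 2-adic integer is a formal sum \<open>\<Sum>i\<ge>0. a\<^sub>i 2\<^sup>i\<close> with digits \<open>a\<^sub>i\<close> in \<open>{0,1}\<close>. Bits are values
  of type \<^typ>\<open>bool\<close>, where \<^const>\<open>True\<close> stands for 1 and \<^const>\<open>False\<close> for 0.
\<close>

datatype z2 = Z2 (digit: "nat \<Rightarrow> bool")

definition psum :: "z2 \<Rightarrow> nat \<Rightarrow> int" where
  "psum z n = (\<Sum>i<n. of_bool (digit z i) * 2 ^ i)"

text \<open>
  Addition and multiplication with carries: digit \<open>i\<close> of the result is determined by the
  digits \<open>0, \<dots>, i\<close> of the arguments, so it is read off from the integer result for the partial
  sums of length \<open>i + 1\<close>.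
\<close>

definition z2_of_approx :: "(nat \<Rightarrow> int) \<Rightarrow> z2" where
  "z2_of_approx F = Z2 (\<lambda>i. bit (F (Suc i)) i)"

instantiation z2 :: "{zero, one, plus, minus, uminus, times}"
begin

definition zero_z2 :: z2 where
  "0 = Z2 (\<lambda>i. False)"

definition one_z2 :: z2 where
  "1 = Z2 (\<lambda>i. i = 0)"

definition plus_z2 :: "z2 \<Rightarrow> z2 \<Rightarrow> z2" where
  "z + w = z2_of_approx (\<lambda>n. psum z n + psum w n)"

definition minus_z2 :: "z2 \<Rightarrow> z2 \<Rightarrow> z2" where
  "z - w = z2_of_approx (\<lambda>n. psum z n - psum w n)"

definition uminus_z2 :: "z2 \<Rightarrow> z2" where
  "- z = z2_of_approx (\<lambda>n. - psum z n)"

definition times_z2 :: "z2 \<Rightarrow> z2 \<Rightarrow> z2" where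
  "z * w = z2_of_approx (\<lambda>n. psum z n * psum w n)"

instance ..

end

lemma bit_psum: "bit (psum z n) i \<longleftrightarrow> i < n \<and> digit z i"
proof -
  have "psum z n = horner_sum of_bool 2 (map (digit z) [0..<n])"
    by (simp add: psum_def horner_sum_eq_sum atLeast0LessThan)
  then show ?thesis
    by (auto simp add: bit_horner_sum_bit_iff)
qed

lemma take_bit_psum: "m \<le> n \<Longrightarrow> take_bit m (psum z n) = psum z m"
  by (rule bit_eqI) (auto simp add: bit_take_bit_iff bit_psum)

lemma psum_mod: "psum z n mod 2 ^ n = psum z n"
  using take_bit_psum [of n n z] by (simp add: take_bit_eq_mod)

lemma z2_eqI:
  assumes "\<And>n. psum z n = psum w n"
  shows "z = w"
proof (rule z2.expand, rule ext)
  fix i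
  show "digit z i = digit w i"
    using assms [of "Suc i"] bit_psum [of z "Suc i" i] bit_psum [of w "Suc i" i] by simp
qed

lemma psum_z2_of_approx:
  assumes "\<And>m n. m \<le> n \<Longrightarrow> take_bit m (F n) = take_bit m (F m)"
  shows "psum (z2_of_approx F) n = take_bit n (F n)"
proof (rule bit_eqI)
  fix i
  have "bit (F (Suc i)) i = bit (F n) i" if "i < n"
    using assms [of "Suc i" n] that
    by (metis Suc_leI bit_take_bit_iff lessI)
  then show "bit (psum (z2_of_approx F) n) i = bit (take_bit n (F n)) i"
    by (auto simp add: bit_psum bit_take_bit_iff z2_of_approx_def)
qed

lemma psum_zero: "psum 0 n = 0"
  by (simp add: psum_def zero_z2_def)

lemma psum_one: "psum 1 n = 1 mod 2 ^ n"
proof -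
  have "psum 1 n = take_bit n 1"
    by (rule bit_eqI) (auto simp add: bit_psum one_z2_def bit_take_bit_iff bit_1_iff)
  then show ?thesis by (simp only: take_bit_eq_mod)
qed

lemma psum_plus: "psum (z + w) n = (psum z n + psum w n) mod 2 ^ n"
  unfolding plus_z2_def
  by (subst psum_z2_of_approx)
     (metis take_bit_add take_bit_psum order_refl, simp add: take_bit_eq_mod)

lemma psum_minus: "psum (z - w) n = (psum z n - psum w n) mod 2 ^ n"
  unfolding minus_z2_def
  by (subst psum_z2_of_approx)
     (metis take_bit_diff take_bit_psum order_refl, simp add: take_bit_eq_mod)

lemma psum_uminus: "psum (- z) n = (- psum z n) mod 2 ^ n"
  unfolding uminus_z2_def
  by (subst psum_z2_of_approx)
     (metis take_bit_minus take_bit_psum order_refl, simp add: take_bit_eq_mod)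

lemma psum_times: "psum (z * w) n = (psum z n * psum w n) mod 2 ^ n"
  unfolding times_z2_def
  by (subst psum_z2_of_approx)
     (metis take_bit_mult take_bit_psum order_refl, simp add: take_bit_eq_mod)

lemmas psum_arith =
  psum_zero psum_one psum_plus psum_minus psum_uminus psum_times psum_mod

instance z2 :: comm_ring_1
proof
  fix a b c :: z2
  show "a * b * c = a * (b * c)"
    by (rule z2_eqI) (simp add: psum_arith mod_simps mult.assoc)
  show "a * b = b * a"
    by (rule z2_eqI) (simp add: psum_arith mult.commute)
  show "1 * a = a"
  proof (rule z2_eqI)
    fix n
    have "psum (1 * a) n = (1 * psum a n) mod 2 ^ n"
      by (simp only: psum_times psum_one mod_mult_left_eq)
    then show "psum (1 * a) n = psum a n" by (simp add: psum_mod)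
  qed
  show "a + b + c = a + (b + c)"
    by (rule z2_eqI) (simp add: psum_arith mod_simps add.assoc)
  show "a + b = b + a"
    by (rule z2_eqI) (simp add: psum_arith add.commute)
  show "0 + a = a"
    by (rule z2_eqI) (simp add: psum_arith)
  show "- a + a = 0"
    by (rule z2_eqI) (simp add: psum_arith mod_simps)
  show "a - b = a + - b"
    by (rule z2_eqI) (simp add: psum_arith mod_simps)
  show "(a + b) * c = a * c + b * c"
    by (rule z2_eqI) (simp add: psum_arith mod_simps distrib_right)
  show "(0::z2) \<noteq> 1"
    by (simp add: zero_z2_def one_z2_def fun_eq_iff)
qed

text \<open>The embedding of the integers is \<^const>\<open>of_int\<close>.\<close>

lemma psum_of_int: "psum (of_int x) n = x mod 2 ^ n"
proof -
  have nat: "psum (of_nat m) n = int m mod 2 ^ n" for m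
    by (induction m) (simp_all add: psum_arith mod_simps add.commute)
  show ?thesis
    by (cases x rule: int_cases2) (simp_all add: nat psum_arith mod_simps)
qed

lemma digit_of_int: "digit (of_int x) i = bit x i"
  using bit_psum [of "of_int x" "Suc i" i]
  by (simp add: psum_of_int bit_take_bit_iff flip: take_bit_eq_mod power_Suc)

lemma of_int_z2_inject: "(of_int x :: z2) = of_int y \<longleftrightarrow> x = y"
  by (metis bit_eqI digit_of_int)


section \<open>The bracket bit\<close>

lemma digit_double: "digit (2 * z) i \<longleftrightarrow> 0 < i \<and> digit z (i - 1)"
proof -
  have "psum (2 * z) (Suc i) = take_bit (Suc i) (2 * psum z (Suc i))"
    by (simp only: mult_2 psum_plus take_bit_eq_mod)
  then have "digit (2 * z) i \<longleftrightarrow> bit (2 * psum z (Suc i)) i"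
    using bit_psum [of "2 * z" "Suc i" i] by (simp add: bit_take_bit_iff)
  also have "\<dots> \<longleftrightarrow> 0 < i \<and> digit z (i - 1)"
    by (cases i) (simp_all add: bit_0 bit_double_iff bit_psum)
  finally show ?thesis .
qed

lemma digit_double_plus_one: "digit (2 * z + 1) i \<longleftrightarrow> i = 0 \<or> digit z (i - 1)"
proof -
  have even: "even (psum (2 * z) (Suc i))"
    using bit_psum [of "2 * z" "Suc i" 0] by (simp add: bit_0 digit_double)
  have "psum (2 * z + 1) (Suc i) = take_bit (Suc i) (psum (2 * z) (Suc i) + 1)"
    by (simp only: psum_plus psum_one mod_simps take_bit_eq_mod)
  then have "digit (2 * z + 1) i \<longleftrightarrow> bit (psum (2 * z) (Suc i) + 1) i"
    using bit_psum [of "2 * z + 1" "Suc i" i] by (simp add: bit_take_bit_iff)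
  also have "\<dots> \<longleftrightarrow> i = 0 \<or> bit (psum (2 * z) (Suc i)) i"
    using even by (cases i) (auto simp add: bit_0 bit_Suc)
  finally show ?thesis by (auto simp add: bit_psum digit_double)
qed

lemma digit_mult_power: "digit (z * 2 ^ k) i \<longleftrightarrow> k \<le> i \<and> digit z (i - k)"
proof (induction k arbitrary: i)
  case (Suc k)
  have "z * 2 ^ Suc k = 2 * (z * 2 ^ k)" by (simp add: mult_ac)
  then have "digit (z * 2 ^ Suc k) i \<longleftrightarrow> 0 < i \<and> k \<le> i - 1 \<and> digit z (i - 1 - k)"
    by (simp only: digit_double Suc.IH)
  then show ?case by (cases i) auto
qed simp

lemma digit_decomp:
  "digit ((2 * i + 1) * 2 ^ k) j \<longleftrightarrow> k \<le> j \<and> (j = k \<or> digit i (j - k - 1))"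
  by (auto simp add: digit_mult_power digit_double_plus_one)

lemma z2_decomp_unique:
  assumes "(2 * i + 1) * 2 ^ k = (2 * i' + 1) * (2 ^ k' :: z2)"
  shows "k = k' \<and> i = i'"
proof -
  have eq: "(k \<le> j \<and> (j = k \<or> digit i (j - k - 1))) =
      (k' \<le> j \<and> (j = k' \<or> digit i' (j - k' - 1)))" for j
    using assms by (simp only: flip: digit_decomp)
  have "k = k'"
    using eq [of k] eq [of k'] by auto
  moreover have "digit i j = digit i' j" for j
    using eq [of "Suc (k + j)"] \<open>k = k'\<close> by simp
  ultimately show ?thesis by (auto intro: z2.expand)
qed

lemma z2_decomp_exists:
  fixes z :: z2
  assumes "z \<noteq> 0"
  shows "\<exists>k i. z = (2 * i + 1) * 2 ^ k"
proof -
  have ex: "\<exists>k. digit z k"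
    using assms by (cases z) (auto simp add: zero_z2_def)
  define k where "k = (LEAST k. digit z k)"
  have k: "digit z k" "\<And>j. j < k \<Longrightarrow> \<not> digit z j"
    using ex by (auto simp add: k_def intro: LeastI_ex dest: not_less_Least)
  have "digit z j = digit ((2 * Z2 (\<lambda>j. digit z (Suc (k + j))) + 1) * 2 ^ k) j" for j
    using k by (cases "j < k"; cases "j = k") (auto simp add: digit_decomp)
  then show ?thesis by (intro exI z2.expand ext)
qed

definition z2_rank :: "z2 \<Rightarrow> nat" where
  "z2_rank z = (THE k. \<exists>i. z = (2 * i + 1) * 2 ^ k)"

definition bracket_bit :: "bool \<Rightarrow> z2 \<Rightarrow> bool" where
  "bracket_bit d z =
     (if z = 0 then d else digit (THE i. z = (2 * i + 1) * 2 ^ z2_rank z) 0)"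

lemma z2_rank_decomp: "z2_rank ((2 * i + 1) * 2 ^ k) = k"
  unfolding z2_rank_def by (rule the_equality) (auto dest: z2_decomp_unique)

lemma bracket_bit_zero: "bracket_bit d 0 = d"
  by (simp add: bracket_bit_def)

lemma bracket_bit_decomp: "bracket_bit d ((2 * i + 1) * 2 ^ k) = digit i 0"
proof -
  have "digit ((2 * i + 1) * 2 ^ k) k" by (simp add: digit_decomp)
  then have "(2 * i + 1) * 2 ^ k \<noteq> (0 :: z2)"
    by (metis z2.sel zero_z2_def)
  moreover have "(THE i'. (2 * i + 1) * 2 ^ k = (2 * i' + 1) * (2 ^ k :: z2)) = i"
    by (rule the_equality) (auto dest: z2_decomp_unique)
  ultimately show ?thesis
    by (simp only: bracket_bit_def z2_rank_decomp if_False)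
qed

lemma bracket_bit_eq_digit:
  assumes "z \<noteq> 0"
  shows "bracket_bit d z = digit z (Suc (z2_rank z))"
  using z2_decomp_exists [OF assms]
  by (auto simp add: bracket_bit_decomp z2_rank_decomp digit_decomp)

lemma bracket_bit_uminus:
  assumes "z \<noteq> 0"
  shows "bracket_bit d (- z) \<longleftrightarrow> \<not> bracket_bit d z"
proof -
  obtain k i where z: "z = (2 * i + 1) * 2 ^ k"
    using z2_decomp_exists [OF assms] by blast
  have psum1: "psum w 1 = of_bool (digit w 0)" for w
    by (simp add: psum_def)
  have "psum (- i - 1) 1 = (- psum i 1 - 1) mod 2"
    by (simp add: psum_minus psum_uminus psum_one mod_simps)
  then have digit: "digit (- i - 1) 0 \<longleftrightarrow> \<not> digit i 0"
    unfolding psum1 by (cases "digit i 0"; cases "digit (- i - 1) 0") simp_all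
  have "- z = (2 * (- i - 1) + 1) * 2 ^ k"
    by (simp add: z algebra_simps)
  then show ?thesis
    by (simp only: z bracket_bit_decomp digit not_False_eq_True)
qed


section \<open>Tilings of the edge grid\<close>

text \<open>
  \<open>HEdge x y\<close> joins \<open>(x, y)\<close> to \<open>(x + 1, y)\<close>, and \<open>VEdge x y\<close> joins \<open>(x, y)\<close> to \<open>(x, y + 1)\<close>.
\<close>

datatype edge = HEdge int int | VEdge int int

type_synonym 'k tiling = "edge \<Rightarrow> 'k"

type_synonym 'k tile = "'k \<times> 'k \<times> 'k \<times> 'k"

text \<open>The unit square with lower left corner \<open>(x, y)\<close>; order of edges: left, right, bottom, top.\<close>

definition tile_at :: "'k tiling \<Rightarrow> int \<Rightarrow> int \<Rightarrow> 'k tile" where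
  "tile_at T x y = (T (VEdge x y), T (VEdge (x + 1) y), T (HEdge x y), T (HEdge x (y + 1)))"

definition palette :: "'k set \<Rightarrow> 'k tile set \<Rightarrow> bool" where
  "palette K P \<longleftrightarrow> finite P \<and> P \<subseteq> K \<times> K \<times> K \<times> K"

definition palette_tilings :: "'k set \<Rightarrow> 'k tile set \<Rightarrow> 'k tiling set" where
  "palette_tilings K P = {T. range T \<subseteq> K \<and> (\<forall>x y. tile_at T x y \<in> P)}"

definition enforces :: "'k set \<Rightarrow> 'k tile set \<Rightarrow> ('k \<Rightarrow> 'c) \<Rightarrow> 'c tiling set \<Rightarrow> bool" where
  "enforces K P f S \<longleftrightarrow> (\<forall>T \<in> palette_tilings K P. f \<circ> T \<in> S)"

fun bracket_tiling :: "z2 \<Rightarrow> z2 \<Rightarrow> bool \<Rightarrow> bool \<Rightarrow> bool tiling" where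
  "bracket_tiling a b d1 d2 (VEdge x y) = bracket_bit d1 (of_int x - a)"
| "bracket_tiling a b d1 d2 (HEdge x y) = bracket_bit d2 (of_int y - b)"

text \<open>
  The 2-adic shifts and reflections of the central tiling \<open>bracket_tiling 0 0 d1 d2\<close>. Reflections
  need no parameter of their own: for nonzero \<open>z\<close>, the bracket bits of \<open>z\<close> and \<open>- z\<close> are opposite,
  so that reflecting a tiling amounts to a change of \<open>a\<close>, \<open>b\<close> and of the default bits.
\<close>

definition central_tilings :: "bool tiling set" where
  "central_tilings = {bracket_tiling a b d1 d2 | a b d1 d2. True}"

end

theory Submission
  imports Defs "HOL-Library.Countable"
begin

text \<open>
  Besides the two bracket bits, the cell at \<open>(x, y)\<close> of a row of rank \<open>j\<close> records the position of
  \<open>x\<close> modulo \<open>2^(j + 2)\<close> at resolution \<open>2^(j - 1)\<close>, as a residue modulo 16 that can be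
  propagated by nearest-neighbour rules; its column does the same with \<open>y\<close>. Both residues reveal
  the difference of the ranks of \<open>x\<close> and \<open>y\<close>, truncated to \<open>[-2, 2]\<close>, and have to agree on it.
  Once the cells of rank 0 are known to be the odd ones, the brackets of rank 0 must alternate,
  the rows and columns enclosed by them must have rank 1, and the cells in even rows and
  columns again satisfy all the rules. Iterating this halving yields the binary digits of
  the shifts one by one.
\<close>

section \<open>Palettes from nearest-neighbour constraints\<close>

definition nn_configs :: "'a set \<Rightarrow> ('a \<Rightarrow> 'a \<Rightarrow> bool) \<Rightarrow> ('a \<Rightarrow> 'a \<Rightarrow> bool) \<Rightarrow> (int \<Rightarrow> int \<Rightarrow> 'a) set"
  where "nn_configs A H V =
    {c. \<forall>x y. c x y \<in> A \<and> H (c x y) (c (x + 1) y) \<and> V (c x y) (c x (y + 1))}"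

fun edge_bits :: "('a \<Rightarrow> bool) \<Rightarrow> ('a \<Rightarrow> bool) \<Rightarrow> (int \<Rightarrow> int \<Rightarrow> 'a) \<Rightarrow> bool tiling" where
  "edge_bits g h c (VEdge x y) = g (c x y)"
| "edge_bits g h c (HEdge x y) = h (c x y)"

text \<open>Both the left and the bottom edge of a unit square carry the symbol of that square; the
  Boolean tag tells vertical from horizontal edges.\<close>

lemma palette_of_nn_configs:
  fixes A :: "'a::countable set"
  assumes "finite A" and "nn_configs A H V \<noteq> {}"
    and S: "\<And>c. c \<in> nn_configs A H V \<Longrightarrow> edge_bits g h c \<in> S"
  shows "\<exists>(K :: nat set) (P :: nat tile set) (f :: nat \<Rightarrow> bool).
    finite K \<and> palette K P \<and> palette_tilings K P \<noteq> {} \<and> enforces K P f S"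
proof -
  define ve where "ve a = to_nat (True, a)" for a :: 'a
  define he where "he a = to_nat (False, a)" for a :: 'a
  define K where "K = ve ` A \<union> he ` A"
  define P where "P = {(ve a, ve b, he a, he c) | a b c. a \<in> A \<and> b \<in> A \<and> c \<in> A \<and> H a b \<and> V a c}"
  define f where "f n = (case from_nat n of (t, a) \<Rightarrow> if t then g a else h a)" for n
  have inj: "ve a = ve b \<longleftrightarrow> a = b" "he a = he b \<longleftrightarrow> a = b" for a b
    by (auto simp: ve_def he_def)
  have f: "f (ve a) = g a" "f (he a) = h a" for a
    by (simp_all add: f_def ve_def he_def)
  have K: "finite K"
    using \<open>finite A\<close> by (simp add: K_def)
  have "P \<subseteq> K \<times> K \<times> K \<times> K"
    by (auto simp: P_def K_def)
  then have P: "palette K P"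
    using K by (auto simp: palette_def intro: finite_subset)
  obtain c where c: "c \<in> nn_configs A H V"
    using assms(2) by blast
  define T where "T e = (case e of VEdge x y \<Rightarrow> ve (c x y) | HEdge x y \<Rightarrow> he (c x y))" for e
  have "range T \<subseteq> K"
    using c by (auto simp: T_def K_def nn_configs_def split: edge.splits)
  moreover have "tile_at T x y \<in> P" for x y
    using c unfolding P_def nn_configs_def tile_at_def T_def by simp blast
  ultimately have "palette_tilings K P \<noteq> {}"
    by (auto simp: palette_tilings_def)
  moreover have "enforces K P f S"
    unfolding enforces_def
  proof
    fix T
    assume "T \<in> palette_tilings K P"
    then have "\<exists>a b c. tile_at T x y = (ve a, ve b, he a, he c)
        \<and> a \<in> A \<and> b \<in> A \<and> c \<in> A \<and> H a b \<and> V a c" for x y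
      by (auto simp: palette_tilings_def P_def)
    then obtain c0 c1 c2 where c: "\<And>x y. tile_at T x y = (ve (c0 x y), ve (c1 x y), he (c0 x y), he (c2 x y))
        \<and> c0 x y \<in> A \<and> c1 x y \<in> A \<and> c2 x y \<in> A \<and> H (c0 x y) (c1 x y) \<and> V (c0 x y) (c2 x y)"
      by metis
    have T: "T (VEdge x y) = ve (c0 x y)" "T (VEdge (x + 1) y) = ve (c1 x y)"
        "T (HEdge x y) = he (c0 x y)" "T (HEdge x (y + 1)) = he (c2 x y)" for x y
      using c[of x y] by (simp_all add: tile_at_def)
    \<comment> \<open>The right and top edges of a square are the left and bottom edges of its
      neighbours, so injectivity of the encoding glues the choices made per square into one
      configuration.\<close>
    have "c1 x y = c0 (x + 1) y" "c2 x y = c0 x (y + 1)" for x y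
      using T(2)[of x y] T(1)[of "x + 1" y] T(4)[of x y] T(3)[of x "y + 1"] by (simp_all add: inj)
    then have "c0 \<in> nn_configs A H V"
      using c by (simp add: nn_configs_def)
    moreover have "f \<circ> T = edge_bits g h c0"
    proof
      fix e
      show "(f \<circ> T) e = edge_bits g h c0 e"
        by (cases e) (simp_all add: T f)
    qed
    ultimately show "f \<circ> T \<in> S"
      using S by simp
  qed
  ultimately show ?thesis
    using K P by blast
qed


section \<open>Bracket sequences\<close>

text \<open>If \<open>u x\<close> is the bracket bit of \<open>x - 2 * a\<close>, then
  \<open>u 1\<close> is the lowest digit of \<open>a\<close>, and halving yields a sequence of the
  same form with that digit removed from \<open>a\<close>.\<close>

definition halve :: "(int \<Rightarrow> bool) \<Rightarrow> int \<Rightarrow> bool" where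
  "halve u x = u (2 * x + 2 * of_bool (u 1))"

definition alternates :: "(int \<Rightarrow> bool) \<Rightarrow> bool" where
  "alternates u \<longleftrightarrow>
    (\<forall>m. \<not> u (4 * m + 1 + 2 * of_bool (u 1)) \<and> u (4 * m + 3 + 2 * of_bool (u 1)))"

lemma double_z2_inject: "2 * z = 2 * w \<longleftrightarrow> z = (w :: z2)"
proof
  assume "2 * z = 2 * w"
  then have "digit (2 * z) (Suc i) = digit (2 * w) (Suc i)" for i
    by simp
  then show "z = w"
    by (intro z2.expand ext) (simp add: digit_double)
qed simp

lemma Z2_unfold: "Z2 e = 2 * Z2 (\<lambda>i. e (Suc i)) + of_bool (e 0)"
proof (rule z2.expand, rule ext)
  fix i
  show "digit (Z2 e) i = digit (2 * Z2 (\<lambda>i. e (Suc i)) + of_bool (e 0)) i"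
    by (cases i; cases "e 0") (simp_all add: digit_double digit_double_plus_one)
qed

text \<open>Induction on the rank of \<open>x - 2 * a\<close>: rank 0 is settled by alternation, and
  a positive rank drops by one in the halved sequence. The shift is even because the odd positions
  have rank 0.\<close>

lemma bracket_sequence:
  assumes alt: "\<And>k. alternates ((halve ^^ k) u)"
  shows "\<exists>a d. \<forall>x. u x = bracket_bit d (of_int x - 2 * a)"
proof -
  define w where "w k = (halve ^^ k) u" for k
  \<comment> \<open>Each halving reveals one digit, so \<open>b k\<close> is half the shift of the
    \<open>k\<close>-th halved sequence.\<close>
  define b where "b k = Z2 (\<lambda>i. w (k + i) 1)" for k
  have b: "b k = 2 * b (Suc k) + of_int (of_bool (w k 1))" for k
    using Z2_unfold[of "\<lambda>i. w (k + i) 1"] by (simp add: b_def)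
  have w: "w (Suc k) x = w k (2 * x + 2 * of_bool (w k 1))" for k x
    by (simp add: w_def halve_def)
  have main: "w k x = digit i 0" if "of_int x - 2 * b k = (2 * i + 1) * 2 ^ n" for n k x i
    using that
  proof (induction n arbitrary: k x)
    case 0
    define e :: int where "e = of_bool (w k 1)"
    from 0 have eq: "of_int x = 2 * (i + b k) + 1"
      by (simp add: algebra_simps)
    have "digit (of_int x) 0"
      unfolding eq digit_double_plus_one by simp
    then have "odd x"
      by (simp add: digit_of_int bit_0)
    then have "\<exists>m. x = 4 * m + 1 + 2 * e \<or> x = 4 * m + 3 + 2 * e"
      by presburger
    then obtain m where "x = 4 * m + 1 + 2 * e \<or> x = 4 * m + 3 + 2 * e"
      by blast
    then show ?case
    proof
      assume x: "x = 4 * m + 1 + 2 * e"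
      have "of_int x - 2 * b k = (2 * (2 * (of_int m - b (Suc k))) + 1) * 2 ^ 0"
        by (subst b) (simp add: x e_def algebra_simps)
      then have "i = 2 * (of_int m - b (Suc k))"
        using 0 z2_decomp_unique by metis
      then show ?thesis
        using alt[of k] unfolding \<open>i = _\<close> digit_double by (simp add: alternates_def x e_def flip: w_def)
    next
      assume x: "x = 4 * m + 3 + 2 * e"
      have "of_int x - 2 * b k = (2 * (2 * (of_int m - b (Suc k)) + 1) + 1) * 2 ^ 0"
        by (subst b) (simp add: x e_def algebra_simps)
      then have "i = 2 * (of_int m - b (Suc k)) + 1"
        using 0 z2_decomp_unique by metis
      then show ?thesis
        using alt[of k] unfolding \<open>i = _\<close> digit_double_plus_one by (simp add: alternates_def x e_def flip: w_def)
    qed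
  next
    case (Suc n)
    define e :: int where "e = of_bool (w k 1)"
    from Suc.prems have eq: "of_int x = 2 * ((2 * i + 1) * 2 ^ n + b k)"
      by (simp add: algebra_simps)
    have "\<not> digit (of_int x) 0"
      unfolding eq digit_double by simp
    then have "even x"
      by (simp add: digit_of_int bit_0)
    then have "\<exists>m. x = 2 * m + 2 * e"
      by presburger
    then obtain m where x: "x = 2 * m + 2 * e"
      by blast
    have "2 * (of_int m - 2 * b (Suc k)) = of_int x - 2 * b k"
      by (subst (2) b) (simp add: x e_def algebra_simps)
    also have "\<dots> = 2 * ((2 * i + 1) * 2 ^ n)"
      using Suc.prems by (simp add: algebra_simps)
    finally have "of_int m - 2 * b (Suc k) = (2 * i + 1) * 2 ^ n"
      by (simp only: double_z2_inject)
    from Suc.IH[OF this] show ?case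
      by (simp add: w x e_def)
  qed
  \<comment> \<open>At most one integer equals \<open>2 * b 0\<close>. The bit there is
    unconstrained and becomes the default; if there is no such integer, any default would
    do.\<close>
  define d where "d = (\<exists>x. of_int x = 2 * b 0 \<and> u x)"
  have "u x = bracket_bit d (of_int x - 2 * b 0)" for x
  proof (cases "of_int x - 2 * b 0 = 0")
    case True
    then have "of_int y = 2 * b 0 \<longleftrightarrow> y = x" for y
      using of_int_z2_inject[of y x] by auto
    then show ?thesis
      unfolding True by (simp add: d_def bracket_bit_zero)
  next
    case False
    then obtain n i where *: "of_int x - 2 * b 0 = (2 * i + 1) * 2 ^ n"
      using z2_decomp_exists by blast
    then show ?thesis
      using main[OF *] by (simp add: bracket_bit_decomp w_def)
  qed
  then show ?thesis
    by blast
qed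


section \<open>The hierarchical constraints\<close>

text \<open>A residue \<open>p\<close> stands for the position \<open>p * 2^(j - 2)\<close> in a row of rank \<open>j\<close>, odd residues
  standing for all positions strictly between the two neighbouring even ones. The moves by 4, 2
  and 1 occur in rows of rank 0, 1 and at least 2.\<close>

definition step :: "int \<Rightarrow> int \<Rightarrow> bool" where
  "step p q \<longleftrightarrow> q = (p + 1) mod 16 \<or> (odd p \<and> q = p)
    \<or> (even p \<and> q = (p + 2) mod 16) \<or> (4 dvd p \<and> q = (p + 4) mod 16)"

text \<open>The rank of the column minus the rank of the row, truncated to \<open>[-2, 2]\<close>.\<close>

definition lev :: "int \<Rightarrow> int" where
  "lev p = (if p = 0 then 2 else if p = 8 then 1 else if 4 dvd p then 0 else if even p then - 1 else - 2)"

text \<open>This is the invariant of halving. The parity clauses make the odd columns and rows those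
  of rank 0; nothing is said by parity about cells with both coordinates even, which form the next
  level.\<close>

definition hierarchy ::
  "(int \<Rightarrow> int \<Rightarrow> int) \<Rightarrow> (int \<Rightarrow> int \<Rightarrow> int) \<Rightarrow> (int \<Rightarrow> bool) \<Rightarrow> (int \<Rightarrow> bool) \<Rightarrow> bool" where
  "hierarchy r s u v \<longleftrightarrow> (\<forall>x y.
     r x y \<in> {0..<16} \<and> s x y \<in> {0..<16} \<and>
     step (r x y) (r (x + 1) y) \<and> step (s x y) (s x (y + 1)) \<and>
     lev (r x y) = - lev (s x y) \<and>
     (r x y = 4 \<longrightarrow> \<not> u x) \<and> (r x y = 12 \<longrightarrow> u x) \<and>
     (s x y = 4 \<longrightarrow> \<not> v y) \<and> (s x y = 12 \<longrightarrow> v y) \<and>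
     (odd x \<and> odd y \<longrightarrow> lev (r x y) = 0) \<and>
     (odd x \<and> even y \<longrightarrow> lev (r x y) < 0) \<and>
     (even x \<and> odd y \<longrightarrow> lev (r x y) > 0))"

lemma hierarchy_transpose:
  "hierarchy r s u v \<Longrightarrow> hierarchy (\<lambda>x y. s y x) (\<lambda>x y. r y x) v u"
  unfolding hierarchy_def
proof (intro allI, goal_cases)
  case (1 x y)
  then show ?case
    using spec[OF spec[OF 1, of y], of x] by auto
qed

lemma lev_iff:
  "lev p = - 1 \<longleftrightarrow> even p \<and> \<not> 4 dvd p"
  "lev p = - 2 \<longleftrightarrow> odd p"
  "p \<in> {0..<16} \<Longrightarrow> lev p = 0 \<longleftrightarrow> p = 4 \<or> p = 12"
  "p \<in> {0..<16} \<Longrightarrow> lev p > 0 \<longleftrightarrow> p = 0 \<or> p = 8"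
  by (auto simp: lev_def)


section \<open>Brackets forced at rank 0\<close>

text \<open>In an odd row the residues lie in \<open>{4, 12}\<close> at odd columns and in
  \<open>{0, 8}\<close> at even ones, so the only legal moves are those of the cycle 4, 8, 12, 0.
  Hence the brackets alternate, and an enclosed column shows 8, the sign of rank 1.\<close>

lemma hierarchy_odd_rows:
  assumes h: "hierarchy r s u v"
  shows "alternates u"
    and "odd y \<Longrightarrow> r (2 * x + 2 * of_bool (u 1)) y = (if odd x then 8 else 0)"
proof -
  have oo: "r x y = (if u x then 12 else 4)" if "odd x" "odd y" for x y
    using h that lev_iff(3)[of "r x y"] unfolding hierarchy_def by metis
  have eo: "r x y = 0 \<or> r x y = 8" if "even x" "odd y" for x y
    using h that lev_iff(4)[of "r x y"] unfolding hierarchy_def by metis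
  have st: "step (r x y) (r (x + 1) y)" for x y
    using h unfolding hierarchy_def by blast
  have next_r: "r (x + 1) y = (if u x then 0 else 8)" if "odd x" "odd y" for x y
    using oo[OF that] eo[of "x + 1" y] st[of x y] that by (auto simp: step_def split: if_splits)
  have flip: "u (x + 2) \<longleftrightarrow> \<not> u x" if "odd x" for x
    using next_r[of x 1] oo[of "x + 2" 1] st[of "x + 1" 1] that
    by (auto simp: step_def add.assoc split: if_splits)
  have u1: "u (4 * m + 1) \<longleftrightarrow> u 1" for m
  proof (induction m rule: int_induct[where k = 0])
    case (step1 m)
    then show ?case
      using flip[of "4 * m + 1"] flip[of "4 * m + 3"] by (simp add: algebra_simps)
  next
    case (step2 m)
    then show ?case
      using flip[of "4 * m - 3"] flip[of "4 * m - 1"] by (simp add: algebra_simps)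
  qed simp
  have u3: "u (4 * m + 3) \<longleftrightarrow> \<not> u 1" for m
    using flip[of "4 * m + 1"] u1[of m] by (simp add: algebra_simps)
  show "alternates u"
    unfolding alternates_def
  proof
    fix m
    show "\<not> u (4 * m + 1 + 2 * of_bool (u 1)) \<and> u (4 * m + 3 + 2 * of_bool (u 1))"
      \<comment> \<open>If \<open>u 1\<close> holds, the shift by 2 exchanges the classes 1 and 3
        modulo 4, which needs the instance at \<open>m + 1\<close>.\<close>
      using u1[of m] u3[of m] u1[of "m + 1"] by (cases "u 1") (simp_all add: algebra_simps)
  qed
  show "r (2 * x + 2 * of_bool (u 1)) y = (if odd x then 8 else 0)" if y: "odd y"
  proof (cases "odd x")
    case True
    then obtain m where "x = 2 * m + 1"
      by (rule oddE)
    then show ?thesis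
      using next_r[of "4 * m + 1" y] next_r[of "4 * m + 3" y] u1[of m] u3[of m] y
      by (cases "u 1") (simp_all add: algebra_simps)
  next
    case False
    then obtain m where "x = 2 * m"
      by blast
    then show ?thesis
      using next_r[of "4 * m - 1" y] next_r[of "4 * m + 1" y] u1[of m] u3[of "m - 1"] y
      by (cases "u 1") (simp_all add: algebra_simps)
  qed
qed

section \<open>Passing to even rows and columns\<close>

lemma sixteen_cases:
  "p \<in> {0..<16} \<Longrightarrow> p \<in> {0, 1, 2, 3, 4, 5, 6, 7, 8, 9, 10, 11, 12, 13, 14, 15 :: int}"
  unfolding atLeastLessThan_iff insert_iff empty_iff by presburger

text \<open>Skipping an odd residue leaves a total advance of 0, 1 or 2, with 0 only from odd and 2
  only from even residues; all of these are single steps.\<close>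

lemma step_odd_step:
  assumes "step p m" "step m q" "p \<in> {0..<16}" "odd m"
  shows "step p q"
  using sixteen_cases[OF assms(3)] assms(1,2,4) unfolding insert_iff empty_iff
  by (elim disjE) (auto simp: step_def)

text \<open>Between two residues congruent to 2 modulo 4, an odd intermediate residue would lead to
  a multiple of 4 instead, so both moves are by 2.\<close>

lemma step_in_sparse_row:
  assumes "step l p" "step p m" "step m q" "step q n" "l \<in> {0..<16}"
    "even l" "\<not> 4 dvd l" "even m" "\<not> 4 dvd m" "even n" "\<not> 4 dvd n"
  shows "4 dvd p \<and> q = (p + 4) mod 16"
proof -
  have *: "4 dvd p \<and> p = (l + 2) mod 16 \<and> m = (l + 4) mod 16"
    if "step l p" "step p m" "l \<in> {0..<16}" "even l" "\<not> 4 dvd l" "even m" "\<not> 4 dvd m" for l p m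
    using sixteen_cases[OF that(3)] that(1,2,4-) unfolding insert_iff empty_iff
    by (elim disjE) (auto simp: step_def)
  have m: "m \<in> {0..<16}"
    using *[of l p m] assms by simp
  show ?thesis
  proof
    show "4 dvd p"
      using * assms by blast
    have "q = ((l + 4) mod 16 + 2) mod 16" "p = (l + 2) mod 16"
      using *[of l p m] *[of m q n] assms m by blast+
    then show "q = (p + 4) mod 16"
      by (simp add: mod_simps)
  qed
qed

text \<open>The row \<open>2 * y + 2 * of_bool (v 1)\<close> has rank 1 when \<open>y\<close> is odd and larger rank when \<open>y\<close>
  is even.\<close>

lemma hierarchy_even_rows:
  assumes h: "hierarchy r s u v" and f: "f = 2 * of_bool (v 1)" and e: "even e"
  shows "odd y \<Longrightarrow> 4 dvd r (2 * x + e) (2 * y + f)"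
    and "odd y \<Longrightarrow> r (2 * (x + 1) + e) (2 * y + f) = (r (2 * x + e) (2 * y + f) + 4) mod 16"
    and "step (r (2 * x + e) (2 * y + f)) (r (2 * (x + 1) + e) (2 * y + f))"
proof -
  have st: "step (r x y) (r (x + 1) y)" and ran: "r x y \<in> {0..<16}"
    and rs: "lev (r x y) = - lev (s x y)" for x y
    using h unfolding hierarchy_def by blast+
  have s: "s x (2 * y + f) = (if odd y then 8 else 0)" if "odd x" for x
    using hierarchy_odd_rows(2)[OF hierarchy_transpose[OF h] that] f by simp
  let ?r = "\<lambda>i. r (2 * x + e + i) (2 * y + f)"
  have steps: "step (?r (- 1)) (?r 0)" "step (?r 0) (?r 1)" "step (?r 1) (?r 2)" "step (?r 2) (?r 3)"
    using st[of "2 * x + e - 1"] st[of "2 * x + e"] st[of "2 * x + e + 1"] st[of "2 * x + e + 2"]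
    by (simp_all add: algebra_simps)
  have od: "odd (2 * x + e - 1)" "odd (2 * x + e + 1)" "odd (2 * x + e + 3)"
    using e by simp_all
  show dvd: "4 dvd r (2 * x + e) (2 * y + f)"
    and four: "r (2 * (x + 1) + e) (2 * y + f) = (r (2 * x + e) (2 * y + f) + 4) mod 16" if "odd y"
  proof -
    \<comment> \<open>For odd \<open>y\<close> the column residue is 8, so the row has rank 1 more
      than the odd column and \<open>lev\<close> of the row residue is -1.\<close>
    have "even (r x (2 * y + f)) \<and> \<not> 4 dvd r x (2 * y + f)" if "odd x" for x
      using rs[of x "2 * y + f"] s[OF that] \<open>odd y\<close> lev_iff(1) by (simp add: lev_def split: if_splits)
    then have "4 dvd ?r 0 \<and> ?r 2 = (?r 0 + 4) mod 16"
      using steps od by (intro step_in_sparse_row[of "?r (- 1)" _ "?r 1" _ "?r 3"] ran) simp_all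
    then show "4 dvd r (2 * x + e) (2 * y + f)"
      and "r (2 * (x + 1) + e) (2 * y + f) = (r (2 * x + e) (2 * y + f) + 4) mod 16"
      by (simp_all add: algebra_simps)
  qed
  show "step (r (2 * x + e) (2 * y + f)) (r (2 * (x + 1) + e) (2 * y + f))"
  proof (cases "odd y")
    case True
    then show ?thesis
      using dvd four by (simp add: step_def)
  next
    case False
    \<comment> \<open>For even \<open>y\<close> the column residue is 0, so \<open>lev\<close> of
      the row residue is -2.\<close>
    have "odd (?r 1)"
      using rs[of "2 * x + e + 1" "2 * y + f"] s[OF od(2)] False
      by (simp add: lev_def split: if_splits)
    then have "step (?r 0) (?r 2)"
      using step_odd_step steps(2,3) ran by blast
    then show ?thesis
      by (simp add: algebra_simps)
  qed
qed

lemma add_four_cases: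
  assumes "(p + 4) mod 16 = 4 \<or> (p + 4) mod 16 = 12" "p \<in> {0..<16}"
  shows "p = 0 \<or> p = (8 :: int)"
  using assms unfolding atLeastLessThan_iff by presburger

text \<open>Halving lowers the ranks of rows and columns alike and rescales positions accordingly,
  so the residues are kept as they are. Only the parity clauses have to be established anew.\<close>

lemma hierarchy_halve:
  assumes h: "hierarchy r s u v"
  defines "e \<equiv> 2 * of_bool (u 1)" and "f \<equiv> 2 * of_bool (v 1)"
  shows "hierarchy (\<lambda>x y. r (2 * x + e) (2 * y + f)) (\<lambda>x y. s (2 * x + e) (2 * y + f))
    (halve u) (halve v)"
proof -
  let ?r = "\<lambda>x y. r (2 * x + e) (2 * y + f)" and ?s = "\<lambda>x y. s (2 * x + e) (2 * y + f)"
  have ev: "even e" "even f"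
    by (simp_all add: e_def f_def)
  note R = hierarchy_even_rows[OF h meta_eq_to_obj_eq[OF f_def] ev(1)]
  note S = hierarchy_even_rows[OF hierarchy_transpose[OF h] meta_eq_to_obj_eq[OF e_def] ev(2)]
  have ran: "?r x y \<in> {0..<16}" "?s x y \<in> {0..<16}" and rs: "lev (?r x y) = - lev (?s x y)" for x y
    using h unfolding hierarchy_def by blast+
  \<comment> \<open>Multiples of 4 have nonnegative \<open>lev\<close>, and the two values are
    opposite.\<close>
  have oo: "lev (?r x y) = 0" if "odd x" "odd y" for x y
    using R(1)[OF that(2), of x] S(1)[OF that(1), of y] rs[of x y] 
    by (simp add: lev_def split: if_splits)
  \<comment> \<open>The next cell up falls under \<open>oo\<close>, so its column residue is 4 or
    12; moving back by 4 gives 0 or 8.\<close>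
  have oe: "lev (?r x y) < 0" if "odd x" "even y" for x y
  proof -
    have "lev (?s x (y + 1)) = 0"
      using oo[of x "y + 1"] rs[of x "y + 1"] that by simp
    then have "?s x (y + 1) = 4 \<or> ?s x (y + 1) = 12"
      using lev_iff(3) ran by blast
    then have "?s x y = 0 \<or> ?s x y = 8"
      using add_four_cases ran(2) unfolding S(2)[OF that(1)] by blast
    then show ?thesis
      using rs[of x y] by (auto simp: lev_def)
  qed
  have eo: "lev (?r x y) > 0" if "even x" "odd y" for x y
  proof -
    have "lev (?r (x + 1) y) = 0"
      using oo[of "x + 1" y] that by simp
    then have "?r (x + 1) y = 4 \<or> ?r (x + 1) y = 12"
      using lev_iff(3) ran by blast
    then have "?r x y = 0 \<or> ?r x y = 8"
      using add_four_cases ran(1) unfolding R(2)[OF that(2)] by blast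
    then show ?thesis
      by (auto simp: lev_def)
  qed
  have bits: "r x y = 4 \<longrightarrow> \<not> u x" "r x y = 12 \<longrightarrow> u x" "s x y = 4 \<longrightarrow> \<not> v y" "s x y = 12 \<longrightarrow> v y" for x y
    using h unfolding hierarchy_def by blast+
  have hv: "halve u x = u (2 * x + e)" "halve v x = v (2 * x + f)" for x
    by (simp_all add: halve_def e_def f_def)
  show ?thesis
    unfolding hierarchy_def hv
    by (intro allI conjI ran R(3) S(3) rs bits) (use oo oe eo in auto)
qed

lemma hierarchy_brackets:
  assumes "hierarchy r s u v"
  shows "\<exists>a d. \<forall>x. u x = bracket_bit d (of_int x - 2 * a)"
proof (rule bracket_sequence)
  fix k
  have "\<exists>r s. hierarchy r s ((halve ^^ k) u) ((halve ^^ k) v)"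
    using assms by (induction k) (auto intro: hierarchy_halve)
  then show "alternates ((halve ^^ k) u)"
    using hierarchy_odd_rows(1) by blast
qed


section \<open>A hierarchical configuration\<close>

text \<open>The factor in \<open>2 * x\<close> keeps the resolution \<open>2 ^ (k - 1)\<close>
  integral when \<open>k = 0\<close>.\<close>

definition phase :: "nat \<Rightarrow> int \<Rightarrow> int" where
  "phase k x = (2 * (2 * x div 2 ^ k) + of_bool (\<not> 2 ^ k dvd 2 * x)) mod 16"

lemma step_mod:
  "step (z mod 16) ((z + 1) mod 16)"
  "odd z \<Longrightarrow> step (z mod 16) (z mod 16)"
  "even z \<Longrightarrow> step (z mod 16) ((z + 2) mod 16)"
  "4 dvd z \<Longrightarrow> step (z mod 16) ((z + 4) mod 16)"
  by (simp_all add: step_def mod_simps dvd_mod_iff)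

lemma step_phase: "step (phase k x) (phase k (x + 1))"
proof -
  consider "k = 0" | "k = 1" | n where "k = Suc (Suc n)"
    by (metis One_nat_def not0_implies_Suc)
  then show ?thesis
  proof cases
    case 1
    then show ?thesis
      using step_mod(4)[of "4 * x"] by (simp add: phase_def distrib_left)
  next
    case 2
    then show ?thesis
      using step_mod(3)[of "2 * x"] by (simp add: phase_def distrib_left)
  next
    case 3
    \<comment> \<open>\<open>M\<close> is \<open>2 ^ (k - 1)\<close>, the distance between positions
      with even residues; \<open>M \<ge> 2\<close> leaves room for an odd residue in
      between.\<close>
    define M :: int where "M = 2 * 2 ^ n"
    have M: "M \<ge> 2" "even M"
      by (simp_all add: M_def)
    have k: "phase k x = (2 * (x div M) + of_bool (\<not> M dvd x)) mod 16" for x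
    proof -
      have "2 ^ k = 2 * M"
        by (simp add: 3 M_def)
      then show ?thesis
        unfolding phase_def by (simp only: dvd_mult_cancel_left) simp
    qed
    define q where "q = x div M"
    define t where "t = x mod M"
    have x: "x = q * M + t" "0 \<le> t" "t < M"
      unfolding q_def t_def using M(1) by simp_all
    have A: "phase k x = (2 * q + of_bool (t \<noteq> 0)) mod 16"
      unfolding k q_def t_def dvd_eq_mod_eq_0 by (rule refl)
    show ?thesis
    proof (cases "t + 1 = M")
      case True
      then have x1: "x + 1 = (q + 1) * M"
        using x by (simp add: algebra_simps)
      have "phase k (x + 1) = (2 * q + 1 + 1) mod 16"
        unfolding k x1 using M by (simp add: algebra_simps)
      moreover have "phase k x = (2 * q + 1) mod 16"
        unfolding A using True M by simp
      ultimately show ?thesis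
        using step_mod(1) by metis
    next
      case False
      have "x + 1 = M * q + (t + 1)"
        using x(1) by (simp add: mult.commute)
      then have "(x + 1) div M = q" "(x + 1) mod M = t + 1"
        using x(2,3) False int_div_pos_eq[of "x + 1" M q "t + 1"] int_mod_pos_eq[of "x + 1" M q "t + 1"]
        by linarith+
      then have B: "phase k (x + 1) = (2 * q + 1) mod 16"
        unfolding k dvd_eq_mod_eq_0 using x(2) by simp
      show ?thesis
      proof (cases "t = 0")
        case True
        then have "phase k x = (2 * q) mod 16"
          unfolding A by simp
        then show ?thesis
          unfolding B using step_mod(1) by metis
      next
        case False
        then have "phase k x = (2 * q + 1) mod 16"
          unfolding A by simp
        then show ?thesis
          unfolding B using step_mod(2)[of "2 * q + 1"] by simp
      qed
    qed
  qed
qed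

lemma phase_at_rank: "phase k ((2 * i + 1) * 2 ^ k) = (if odd i then 12 else 4)"
proof -
  have "phase k ((2 * i + 1) * 2 ^ k) = (4 * (2 * i + 1)) mod 16"
    by (simp add: phase_def mult.assoc[symmetric])
  also have "\<dots> = (if odd i then 12 else 4)"
    by simp presburger
  finally show ?thesis .
qed

text \<open>Before rounding and reduction the residue is
  \<open>(2 * i + 1) * 2 ^ (k - j + 2)\<close>, whose 2-adic valuation gives \<open>k - j\<close>;
  rounding to odd and reduction modulo 16 truncate it at -2 and 2.\<close>

lemma lev_phase: "lev (phase j ((2 * i + 1) * 2 ^ k)) = max (- 2) (min 2 (int k - int j))"
proof -
  consider n where "j = k + Suc (Suc n)" | "j = Suc k" | n where "k = j + n"
    by (metis add_Suc_right le_Suc_ex linorder_le_less_linear less_iff_Suc_add not0_implies_Suc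
        add.right_neutral)
  then show ?thesis
  proof cases
    case 1
    have "2 ^ j = (2 * 2 ^ k) * (2 * 2 ^ n :: int)" "2 * ((2 * i + 1) * 2 ^ k) = (2 * 2 ^ k) * (2 * i + 1)"
      by (simp_all add: 1 power_add)
    then have "2 ^ j dvd 2 * ((2 * i + 1) * 2 ^ k) \<longleftrightarrow> 2 * 2 ^ n dvd 2 * i + 1"
      by (simp only: dvd_mult_cancel_left) simp
    moreover have "\<not> 2 * 2 ^ n dvd 2 * i + 1"
      by (metis dvd_mult_left even_mult_iff even_plus_one_iff even_numeral)
    ultimately have "\<not> 2 ^ j dvd 2 * ((2 * i + 1) * 2 ^ k)"
      by simp
    then have "odd (phase j ((2 * i + 1) * 2 ^ k))"
      by (simp add: phase_def dvd_mod_iff)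
    then have "lev (phase j ((2 * i + 1) * 2 ^ k)) = - 2"
      using lev_iff(2) by blast
    then show ?thesis
      using 1 by simp
  next
    case 2
    then have "phase j ((2 * i + 1) * 2 ^ k) = (2 * (2 * i + 1)) mod 16"
      by (simp add: phase_def)
    moreover have "even \<dots>" "\<not> 4 dvd \<dots>"
      by presburger+
    ultimately have "lev (phase j ((2 * i + 1) * 2 ^ k)) = - 1"
      using lev_iff(1) by metis
    then show ?thesis
      using 2 by simp
  next
    case 3
    have "2 * ((2 * i + 1) * 2 ^ k) = (2 * (2 * i + 1) * 2 ^ n) * 2 ^ j"
      by (simp add: 3 power_add)
    then have ph: "phase j ((2 * i + 1) * 2 ^ k) = (4 * (2 * i + 1) * 2 ^ n) mod 16"
      by (simp add: phase_def algebra_simps)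
    consider "n = 0" | "n = 1" | m where "n = Suc (Suc m)"
      by (metis One_nat_def not0_implies_Suc)
    then show ?thesis
    proof cases
      case 1
      then show ?thesis
        using 3 phase_at_rank[of j i] by (simp add: lev_def)
    next
      case 2
      then have "phase j ((2 * i + 1) * 2 ^ k) = 8"
        using ph by simp
      then show ?thesis
        using 3 2 by (simp add: lev_def)
    next
      case (3 m)
      then have "4 * (2 * i + 1) * 2 ^ n = ((2 * i + 1) * 2 ^ m) * 16"
        by simp
      then have "phase j ((2 * i + 1) * 2 ^ k) = 0"
        using ph by (simp only: mod_mult_self2_is_0)
      then show ?thesis
        using 3 \<open>k = j + n\<close> by (simp add: lev_def)
    qed
  qed
qed

lemma int_decomp_exists:
  fixes x :: int
  assumes "x \<noteq> 0"
  shows "\<exists>k i. x = (2 * i + 1) * 2 ^ k"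
  using assms
proof (induction "nat \<bar>x\<bar>" arbitrary: x rule: less_induct)
  case less
  show ?case
  proof (cases "even x")
    case True
    then obtain y where y: "x = 2 * y"
      by blast
    with less.prems have "nat \<bar>y\<bar> < nat \<bar>x\<bar>" "y \<noteq> 0"
      by auto
    then obtain k i where "y = (2 * i + 1) * 2 ^ k"
      using less.hyps by blast
    then have "x = (2 * i + 1) * 2 ^ Suc k"
      using y by simp
    then show ?thesis
      by blast
  next
    case False
    then obtain i where "x = (2 * i + 1) * 2 ^ 0"
      by (auto elim: oddE)
    then show ?thesis
      by blast
  qed
qed

text \<open>The axes have infinite rank. The row of rank \<open>\<infinity>\<close> has phase \<open>sgn x\<close>; at the origin the
  column is treated as having the larger rank.\<close>

definition row_phase :: "int \<Rightarrow> int \<Rightarrow> int" where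
  "row_phase x y = (if y = 0 then sgn x mod 16 else phase (z2_rank (of_int y)) x)"

definition col_phase :: "int \<Rightarrow> int \<Rightarrow> int" where
  "col_phase x y = (if x = 0 then 1 else phase (z2_rank (of_int x)) y)"

lemma z2_rank_of_int: "z2_rank (of_int ((2 * i + 1) * 2 ^ k)) = k"
  using z2_rank_decomp[of "of_int i" k] by simp

lemma bracket_bit_of_int: "bracket_bit d (of_int ((2 * i + 1) * 2 ^ k)) \<longleftrightarrow> odd i"
  using bracket_bit_decomp[of d "of_int i" k] by (simp add: digit_of_int bit_0)

lemma hierarchy_exists:
  "hierarchy row_phase col_phase (\<lambda>x. bracket_bit d (of_int x)) (\<lambda>y. bracket_bit d (of_int y))"
  unfolding hierarchy_def
proof (intro allI, goal_cases)
  case (1 x y)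
  have phase0: "phase k 0 = 0" for k
    by (simp add: phase_def)
  have ran: "row_phase x y \<in> {0..<16}" "col_phase x y \<in> {0..<16}"
    by (auto simp: row_phase_def col_phase_def phase_def)
  have st: "step (row_phase x y) (row_phase (x + 1) y)"
    "step (col_phase x y) (col_phase x (y + 1))"
  proof -
    \<comment> \<open>Along the horizontal axis the residues are 15, then 0 at the origin, then 1;
      along the vertical axis the residue 1 repeats.\<close>
    have "step (sgn x mod 16) (sgn (x + 1) mod 16)" "step 1 1"
      by (auto simp: step_def sgn_if)
    then show "step (row_phase x y) (row_phase (x + 1) y)" "step (col_phase x y) (col_phase x (y + 1))"
      using step_phase by (simp_all add: row_phase_def col_phase_def)
  qed
  have main: "lev (row_phase x y) = - lev (col_phase x y) \<and>
     (row_phase x y = 4 \<longrightarrow> \<not> bracket_bit d (of_int x)) \<and> (row_phase x y = 12 \<longrightarrow> bracket_bit d (of_int x)) \<and>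
     (col_phase x y = 4 \<longrightarrow> \<not> bracket_bit d (of_int y)) \<and> (col_phase x y = 12 \<longrightarrow> bracket_bit d (of_int y)) \<and>
     (odd x \<and> odd y \<longrightarrow> lev (row_phase x y) = 0) \<and>
     (odd x \<and> even y \<longrightarrow> lev (row_phase x y) < 0) \<and>
     (even x \<and> odd y \<longrightarrow> lev (row_phase x y) > 0)"
  proof (cases "x = 0 \<or> y = 0")
    case True
    then show ?thesis
      by (auto simp: row_phase_def col_phase_def phase0 lev_def sgn_if)
  next
    case False
    then obtain i k j l where x: "x = (2 * i + 1) * 2 ^ k" and y: "y = (2 * j + 1) * 2 ^ l"
      using int_decomp_exists by metis
    have r: "row_phase x y = phase l ((2 * i + 1) * 2 ^ k)"
      using False by (simp only: row_phase_def if_False y z2_rank_of_int x de_Morgan_disj)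
    have s: "col_phase x y = phase k ((2 * j + 1) * 2 ^ l)"
      using False by (simp only: col_phase_def if_False y z2_rank_of_int x de_Morgan_disj)
    have lr: "lev (row_phase x y) = max (- 2) (min 2 (int k - int l))"
      and ls: "lev (col_phase x y) = max (- 2) (min 2 (int l - int k))"
      by (simp_all only: r s lev_phase)
    have par: "odd x \<longleftrightarrow> k = 0" "odd y \<longleftrightarrow> l = 0"
      by (simp_all add: x y)
    have "lev p = 0" if "p = 4 \<or> p = 12" for p
      using that by (auto simp: lev_def)
    \<comment> \<open>Residues 4 and 12 have \<open>lev\<close> 0, which truncation produces only
      from equal ranks; then \<open>phase_at_rank\<close> applies.\<close>
    then have eq: "k = l" if "row_phase x y \<in> {4, 12} \<or> col_phase x y \<in> {4, 12}"
      using that lr ls by force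
    have "row_phase x y = 4 \<Longrightarrow> \<not> bracket_bit d (of_int x)" "row_phase x y = 12 \<Longrightarrow> bracket_bit d (of_int x)"
      using eq phase_at_rank[of k i] r bracket_bit_of_int[of d i k] unfolding x by (auto split: if_splits)
    moreover have "col_phase x y = 4 \<Longrightarrow> \<not> bracket_bit d (of_int y)" "col_phase x y = 12 \<Longrightarrow> bracket_bit d (of_int y)"
      using eq phase_at_rank[of l j] s bracket_bit_of_int[of d j l] unfolding y by (auto split: if_splits)
    ultimately show ?thesis
      using lr ls par by auto
  qed
  show ?case
    using ran st main by blast
qed


section \<open>The palette\<close>

text \<open>A cell \<open>(r, s, u, v, p, q)\<close> holds the phases of its row and column, the bracket bits of its
  column and row, and the parities of its column and row.\<close>

type_synonym cell = "int \<times> int \<times> bool \<times> bool \<times> bool \<times> bool"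

definition cells :: "cell set" where
  "cells = {(r, s, u, v, p, q). r \<in> {0..<16} \<and> s \<in> {0..<16} \<and>
     lev r = - lev s \<and> (r = 4 \<longrightarrow> \<not> u) \<and> (r = 12 \<longrightarrow> u) \<and> (s = 4 \<longrightarrow> \<not> v) \<and> (s = 12 \<longrightarrow> v) \<and>
     (p \<and> q \<longrightarrow> lev r = 0) \<and> (p \<and> \<not> q \<longrightarrow> lev r < 0) \<and> (\<not> p \<and> q \<longrightarrow> lev r > 0)}"

fun h_adj :: "cell \<Rightarrow> cell \<Rightarrow> bool" where
  "h_adj (r, s, u, v, p, q) (r', s', u', v', p', q') \<longleftrightarrow>
     step r r' \<and> v' = v \<and> p' = (\<not> p) \<and> q' = q"

fun v_adj :: "cell \<Rightarrow> cell \<Rightarrow> bool" where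
  "v_adj (r, s, u, v, p, q) (r', s', u', v', p', q') \<longleftrightarrow>
     step s s' \<and> u' = u \<and> p' = p \<and> q' = (\<not> q)"

fun u_bit :: "cell \<Rightarrow> bool" where
  "u_bit (r, s, u, v, p, q) = u"

fun v_bit :: "cell \<Rightarrow> bool" where
  "v_bit (r, s, u, v, p, q) = v"

lemma finite_cells: "finite cells"
proof (rule finite_subset)
  show "cells \<subseteq> {0..<16} \<times> {0..<16} \<times> UNIV"
    by (auto simp: cells_def)
qed simp

lemma int_constant:
  assumes "\<And>x :: int. f (x + 1) = f x"
  shows "f x = f 0"
proof (induction x rule: int_induct[where k = 0])
  case (step2 i)
  then show ?case
    using assms[of "i - 1"] by simp
qed (simp_all add: assms)

lemma nn_config_hierarchy:
  assumes "c \<in> nn_configs cells h_adj v_adj"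
  obtains r s u v and m n :: int where "hierarchy r s u v"
    "\<And>x y. u_bit (c x y) = u (x - m)" "\<And>x y. v_bit (c x y) = v (y - n)"
proof -
  define r where "r x y = fst (c x y)" for x y
  define s where "s x y = fst (snd (c x y))" for x y
  define u where "u x y = fst (snd (snd (c x y)))" for x y
  define v where "v x y = fst (snd (snd (snd (c x y))))" for x y
  define p where "p x y = fst (snd (snd (snd (snd (c x y)))))" for x y
  define q where "q x y = snd (snd (snd (snd (snd (c x y)))))" for x y
  have c: "c x y = (r x y, s x y, u x y, v x y, p x y, q x y)" for x y
    by (simp add: r_def s_def u_def v_def p_def q_def)
  have cs: "c x y \<in> cells" and hv: "h_adj (c x y) (c (x + 1) y)" "v_adj (c x y) (c x (y + 1))" for x y
    using assms by (auto simp: nn_configs_def)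
  have H: "step (r x y) (r (x + 1) y)" "v (x + 1) y = v x y" "p (x + 1) y = (\<not> p x y)" "q (x + 1) y = q x y"
    and V: "step (s x y) (s x (y + 1))" "u x (y + 1) = u x y" "p x (y + 1) = p x y" "q x (y + 1) = (\<not> q x y)" for x y
    using hv[of x y] by (simp_all add: c)
  have u: "u x y = u x 0" for x y
    using int_constant[of "u x"] V(2) by blast
  have v: "v x y = v 0 y" for x y
    using int_constant[of "\<lambda>x. v x y"] H(2) by blast
  have p: "p x y \<longleftrightarrow> (p 0 0 \<noteq> odd x)" for x y
  proof -
    have "p x y = p x 0"
      using int_constant[of "p x"] V(3) by blast
    \<comment> \<open>Both \<open>p\<close> and the parity of \<open>x\<close> flip at each step, so
      whether they differ is constant.\<close>
    moreover have "(p x 0 \<noteq> odd x) = (p 0 0 \<noteq> odd (0 :: int))"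
      using int_constant[of "\<lambda>x. p x 0 \<noteq> odd x"] H(3) by simp
    ultimately show ?thesis
      by auto
  qed
  have q: "q x y \<longleftrightarrow> (q 0 0 \<noteq> odd y)" for x y
  proof -
    have "q x y = q 0 y"
      using int_constant[of "\<lambda>x. q x y"] H(4) by blast
    moreover have "(q 0 y \<noteq> odd y) = (q 0 0 \<noteq> odd (0 :: int))"
      using int_constant[of "\<lambda>y. q 0 y \<noteq> odd y"] V(4) by simp
    ultimately show ?thesis
      by auto
  qed
  \<comment> \<open>Translating by 0 or 1 makes the recorded parities those of the
    coordinates.\<close>
  define m :: int where "m = of_bool (p 0 0)"
  define n :: int where "n = of_bool (q 0 0)"
  have pq: "p (x + m) y \<longleftrightarrow> odd x" "q x (y + n) \<longleftrightarrow> odd y" for x y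
    using p[of "x + m" y] q[of x "y + n"]
    by (cases "p 0 0"; cases "q 0 0"; simp add: m_def n_def)+
  show thesis
  proof
    show "hierarchy (\<lambda>x y. r (x + m) (y + n)) (\<lambda>x y. s (x + m) (y + n)) (\<lambda>x. u (x + m) 0) (\<lambda>y. v 0 (y + n))"
      unfolding hierarchy_def
    proof (intro allI, goal_cases)
      case (1 x y)
      have shift: "x + 1 + m = x + m + 1" "y + 1 + n = y + n + 1"
        by simp_all
      show ?case
        using cs[of "x + m" "y + n"] H(1)[of "x + m" "y + n"] V(1)[of "x + m" "y + n"]
        unfolding c cells_def mem_Collect_eq prod.case pq u[of "x + m" "y + n"]
          v[of "x + m" "y + n"] shift
        by blast
    qed
    show "u_bit (c x y) = u (x - m + m) 0" for x y
      using u[of x y] by (simp add: c)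
    show "v_bit (c x y) = v 0 (y - n + n)" for x y
      using v[of x y] by (simp add: c)
  qed
qed

lemma nn_configs_nonempty: "nn_configs cells h_adj v_adj \<noteq> {}"
proof -
  define c :: "int \<Rightarrow> int \<Rightarrow> cell" where "c x y = (row_phase x y, col_phase x y,
    bracket_bit False (of_int x), bracket_bit False (of_int y), odd x, odd y)" for x y
  have "c \<in> nn_configs cells h_adj v_adj"
    unfolding nn_configs_def mem_Collect_eq
  proof (intro allI, goal_cases)
    case (1 x y)
    show ?case
      using hierarchy_exists[of False, unfolded hierarchy_def, rule_format, of x y]
      unfolding cells_def c_def by auto
  qed
  then show ?thesis
    by blast
qed

theorem theorem1:
  shows "\<exists>(K :: nat set) (P :: nat tile set) (f :: nat \<Rightarrow> bool).
    finite K \<and> palette K P \<and> palette_tilings K P \<noteq> {} \<and> enforces K P f central_tilings"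
proof (rule palette_of_nn_configs[OF finite_cells nn_configs_nonempty])
  fix c
  assume "c \<in> nn_configs cells h_adj v_adj"
  then obtain r s u v and m n :: int where h: "hierarchy r s u v"
    and c: "\<And>x y. u_bit (c x y) = u (x - m)" "\<And>x y. v_bit (c x y) = v (y - n)"
    by (rule nn_config_hierarchy) blast
  obtain a d where u: "\<And>x. u x = bracket_bit d (of_int x - 2 * a)"
    using hierarchy_brackets[OF h] by blast
  obtain b d' where v: "\<And>y. v y = bracket_bit d' (of_int y - 2 * b)"
    using hierarchy_brackets[OF hierarchy_transpose[OF h]] by blast
  \<comment> \<open>The shift combines the parity offset \<open>m\<close> or \<open>n\<close> with
    the even shift found from the digits.\<close>
  have "edge_bits u_bit v_bit c = bracket_tiling (of_int m + 2 * a) (of_int n + 2 * b) d d'"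
  proof
    fix e
    show "edge_bits u_bit v_bit c e = bracket_tiling (of_int m + 2 * a) (of_int n + 2 * b) d d' e"
      by (cases e) (simp_all add: c u v algebra_simps)
  qed
  then show "edge_bits u_bit v_bit c \<in> central_tilings"
    by (auto simp: central_tilings_def)
qed

end
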